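(* If $n$ is a positive integer with $d(n) = 2$, then $n \equiv -1 \pmod 6$.
   Context: For a finite simple graph $G=(V,E)$, define $\Phi_G(S) = \{v \in V : \lvert N[v]\cap S\rvert \text{ odd}\}$ for $S \subseteq V$, where $N[v]$ is the closed neighborhood of $v$; this is $\mathbb{F}_2$-linear. $d(n)$ denotes $\dim_{\mathbb{F}_2}\ker\Phi_G$ where $G$ is the $n\times n$ grid graph (cells of an $n\times n$ array, adjacent when sharing a side). *)

theory Defs
  imports
    "HOL-Library.Z2"
    "HOL-Library.Function_Algebras"
    "HOL-Library.Indicator_Function"
    "HOL-Number_Theory.Cong"
begin

definition finite_simple_graph :: "'a set \<Rightarrow> 'a set set \<Rightarrow> bool" where
  "finite_simple_graph V E \<longleftrightarrow> finite V \<and> (\<forall>e\<in>E. e \<subseteq> V \<and> card e = 2)"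

definition closed_nbhd :: "'a set \<Rightarrow> 'a set set \<Rightarrow> 'a \<Rightarrow> 'a set" where
  "closed_nbhd V E v = {u \<in> V. u = v \<or> {u, v} \<in> E}"

definition Phi :: "'a set \<Rightarrow> 'a set set \<Rightarrow> 'a set \<Rightarrow> 'a set" where
  "Phi V E S = {v \<in> V. odd (card (closed_nbhd V E v \<inter> S))}"

definition ker_Phi :: "'a set \<Rightarrow> 'a set set \<Rightarrow> 'a set set" where
  "ker_Phi V E = {S. S \<subseteq> V \<and> Phi V E S = {}}"

text \<open>The power set of \<open>V\<close> (with symmetric difference as addition) is regarded as a vector space
  over the two-element field by passing to indicator functions with values in \<open>bit\<close>; the
  functions carry the pointwise operations.\<close>

abbreviation scale_bit :: "bit \<Rightarrow> ('a \<Rightarrow> bit) \<Rightarrow> 'a \<Rightarrow> bit" where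
  "scale_bit \<equiv> \<lambda>c f x. c * f x"

lemma vector_space_scale_bit: "vector_space scale_bit"
  by unfold_locales (auto simp: fun_eq_iff distrib_left distrib_right mult.assoc)

definition ker_Phi_dim :: "'a set \<Rightarrow> 'a set set \<Rightarrow> nat" where
  "ker_Phi_dim V E = vector_space.dim scale_bit ((indicator :: 'a set \<Rightarrow> 'a \<Rightarrow> bit) ` ker_Phi V E)"

definition grid_verts :: "nat \<Rightarrow> (int \<times> int) set" where
  "grid_verts n = {1..int n} \<times> {1..int n}"

text \<open>Two cells share a side iff their coordinates differ by exactly one in exactly one place.\<close>

definition grid_edges :: "nat \<Rightarrow> (int \<times> int) set set" where
  "grid_edges n = {{(i, j), (k, l)} | i j k l.
     (i, j) \<in> grid_verts n \<and> (k, l) \<in> grid_verts n \<and> \<bar>i - k\<bar> + \<bar>j - l\<bar> = 1}"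

definition d_grid :: "nat \<Rightarrow> nat" where
  "d_grid n = ker_Phi_dim (grid_verts n) (grid_edges n)"

lemma finite_simple_graph_grid: "finite_simple_graph (grid_verts n) (grid_edges n)"
  by (auto simp: finite_simple_graph_def grid_verts_def grid_edges_def card_insert_if)

lemma indicator_sym_diff:
  "(indicator (sym_diff S T) :: 'a \<Rightarrow> bit) = indicator S + indicator T"
  by (auto simp: fun_eq_iff indicator_def)

lemma odd_card_sym_diff:
  assumes "finite A" "finite B"
  shows "odd (card (sym_diff A B)) \<longleftrightarrow> odd (card A) \<noteq> odd (card B)"
proof -
  have "card (sym_diff A B) = card (A - B) + card (B - A)"
    using assms by (intro card_Un_disjoint) auto
  moreover have "card A = card (A - B) + card (A \<inter> B)"
    using assms by (metis Diff_disjoint Int_commute Un_Diff_Int card_Un_disjoint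
        finite_Diff finite_Int inf_left_commute inf_bot_right)
  moreover have "card B = card (B - A) + card (A \<inter> B)"
    using assms by (metis Diff_disjoint Int_commute Un_Diff_Int card_Un_disjoint
        finite_Diff finite_Int inf_left_commute inf_bot_right)
  ultimately show ?thesis by presburger
qed

lemma Phi_sym_diff:
  assumes "finite_simple_graph V E"
  shows "Phi V E (sym_diff S T) = sym_diff (Phi V E S) (Phi V E T)"
proof -
  have fin: "finite (closed_nbhd V E v \<inter> U)" for v U
    using assms by (auto simp: finite_simple_graph_def closed_nbhd_def)
  have "closed_nbhd V E v \<inter> sym_diff S T
      = sym_diff (closed_nbhd V E v \<inter> S) (closed_nbhd V E v \<inter> T)" for v
    by blast
  then show ?thesis
    using odd_card_sym_diff[OF fin fin] by (auto simp: Phi_def)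
qed

lemma subspace_ker_Phi:
  assumes "finite_simple_graph V E"
  shows "module.subspace scale_bit ((indicator :: 'a set \<Rightarrow> 'a \<Rightarrow> bit) ` ker_Phi V E)"
proof -
  interpret vector_space "scale_bit :: bit \<Rightarrow> ('a \<Rightarrow> bit) \<Rightarrow> 'a \<Rightarrow> bit"
    by (rule vector_space_scale_bit)
  have zero: "0 \<in> (indicator :: 'a set \<Rightarrow> 'a \<Rightarrow> bit) ` ker_Phi V E"
    by (rule image_eqI[of _ _ "{}"]) (auto simp: fun_eq_iff ker_Phi_def Phi_def)
  show ?thesis
  proof (rule subspaceI)
    fix f g :: "'a \<Rightarrow> bit"
    assume "f \<in> indicator ` ker_Phi V E" "g \<in> indicator ` ker_Phi V E"
    then obtain S T where ST: "S \<in> ker_Phi V E" "f = indicator S" "T \<in> ker_Phi V E" "g = indicator T"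
      by blast
    then have "sym_diff S T \<in> ker_Phi V E"
      using Phi_sym_diff[OF assms, of S T] by (auto simp: ker_Phi_def)
    then show "f + g \<in> indicator ` ker_Phi V E"
      using ST by (metis image_eqI indicator_sym_diff)
  next
    fix c :: bit and f :: "'a \<Rightarrow> bit"
    assume f: "f \<in> indicator ` ker_Phi V E"
    show "scale_bit c f \<in> indicator ` ker_Phi V E"
    proof (cases c)
      case zero
      then show ?thesis using \<open>0 \<in> indicator ` ker_Phi V E\<close> by (simp add: zero_fun_def)
    next
      case one
      then have "scale_bit c f = f" by (simp only: mult_1)
      then show ?thesis using f by (simp only:)
    qed
  qed (rule zero)
qed

end

theory Submission imports Defs begin

text \<open>Let \<open>A\<close> be the adjacency matrix of the path on \<open>n\<close> vertices. The kernel of \<open>\<Phi>\<close> on the grid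
  is the space \<open>K\<close> of \<open>n \<times> n\<close> matrices \<open>X\<close> over the two-element field with \<open>A X + X A + X = 0\<close>. It is
  stable under transposition and under \<open>L X = A X\<close>, and transposition conjugates \<open>L\<close> to \<open>L + 1\<close>.
  If \<open>K\<close> has dimension two, then \<open>L\<close> has an eigenvalue on \<open>K\<close> or satisfies \<open>L\<^sup>2 + L + 1 = 0\<close> there.
  In the first case both \<open>0\<close> and \<open>1\<close> are eigenvalues of \<open>A\<close>, and the corresponding linear recurrences
  give \<open>2 dvd n + 1\<close> and \<open>3 dvd n + 1\<close>. In the second case the columns of \<open>X\<close> are killed by
  \<open>A\<^sup>2 + A + 1\<close>, which forces \<open>5 dvd n + 1\<close>; but then the reflected copies of a solution on the
  \<open>4 \<times> 4\<close> grid form an element of \<open>K\<close> that is not killed by \<open>L\<^sup>2 + L + 1\<close>.\<close>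

section \<open>The kernel on the grid as a space of matrices\<close>

text \<open>This is the map \<open>L\<close>, left multiplication by \<open>A\<close>, on matrices
  extended by zero to all integer positions. The cut-off keeps the extension zero.\<close>

definition vert_sum :: "nat \<Rightarrow> (int \<times> int \<Rightarrow> bit) \<Rightarrow> int \<times> int \<Rightarrow> bit" where
  "vert_sum n f = (\<lambda>(i, j). if (i, j) \<in> grid_verts n then f (i - 1, j) + f (i + 1, j) else 0)"

definition horiz_sum :: "nat \<Rightarrow> (int \<times> int \<Rightarrow> bit) \<Rightarrow> int \<times> int \<Rightarrow> bit" where
  "horiz_sum n f = (\<lambda>(i, j). if (i, j) \<in> grid_verts n then f (i, j - 1) + f (i, j + 1) else 0)"

definition supp_on_grid :: "nat \<Rightarrow> (int \<times> int \<Rightarrow> bit) \<Rightarrow> bool" where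
  "supp_on_grid n f \<longleftrightarrow> (\<forall>p. p \<notin> grid_verts n \<longrightarrow> f p = 0)"

definition grid_null :: "nat \<Rightarrow> (int \<times> int \<Rightarrow> bit) set" where
  "grid_null n = {f. supp_on_grid n f \<and> (\<forall>p. vert_sum n f p + horiz_sum n f p + f p = 0)}"

\<comment> \<open>These two turn bit sums into \<open>of_bool\<close> expressions, on which the ring lemmas no longer apply.\<close>
declare add_bit_eq_xor [simp del] mult_bit_eq_and [simp del]

lemma bit_add_self [simp]: "a + a = (0 :: bit)" "a + (a + b) = (b :: bit)"
  by (cases a; cases b; simp)+

lemma of_nat_bit_eq_0_iff: "(of_nat m :: bit) = 0 \<longleftrightarrow> even m"
  by (induction m) auto

lemma bit_add_eq_0_iff: "a + b = (0 :: bit) \<longleftrightarrow> a = b"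
  by (cases a; cases b) auto

lemma closed_nbhd_grid:
  assumes "(i, j) \<in> grid_verts n"
  shows "closed_nbhd (grid_verts n) (grid_edges n) (i, j)
    = grid_verts n \<inter> {(i, j), (i - 1, j), (i + 1, j), (i, j - 1), (i, j + 1)}"
proof -
  have "{(k, l), (i, j)} \<in> grid_edges n \<longleftrightarrow> (k, l) \<in> grid_verts n \<and> \<bar>k - i\<bar> + \<bar>l - j\<bar> = 1" for k l
  proof
    assume "{(k, l), (i, j)} \<in> grid_edges n"
    then show "(k, l) \<in> grid_verts n \<and> \<bar>k - i\<bar> + \<bar>l - j\<bar> = 1"
      by (auto simp: grid_edges_def doubleton_eq_iff)
  qed (use assms in \<open>auto simp: grid_edges_def\<close>)
  moreover have "\<bar>k - i\<bar> + \<bar>l - j\<bar> = 1 \<longleftrightarrow>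
      (k, l) \<in> {(i - 1, j), (i + 1, j), (i, j - 1), (i, j + 1)}" for k l
    by auto
  ultimately show ?thesis
    using assms by (auto simp: closed_nbhd_def)
qed

lemma even_card_nbhd_grid_iff:
  assumes "(i, j) \<in> grid_verts n" "S \<subseteq> grid_verts n"
  shows "even (card (closed_nbhd (grid_verts n) (grid_edges n) (i, j) \<inter> S)) \<longleftrightarrow>
    vert_sum n (indicator S) (i, j) + horiz_sum n (indicator S) (i, j) + indicator S (i, j) = 0"
proof -
  let ?N = "{(i, j), (i - 1, j), (i + 1, j), (i, j - 1), (i, j + 1)}"
  have "closed_nbhd (grid_verts n) (grid_edges n) (i, j) \<inter> S = ?N \<inter> S"
    using assms by (auto simp: closed_nbhd_grid)
  \<comment> \<open>Parity of a cardinality is its image in \<open>bit\<close>, so counting turns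
    into adding indicator values.\<close>
  moreover have "(of_nat (card (?N \<inter> S)) :: bit) = (\<Sum>p\<in>?N. indicator S p)"
    by (simp add: indicator_def sum.If_cases Int_def)
  moreover have "(\<Sum>p\<in>?N. indicator S p)
      = vert_sum n (indicator S) (i, j) + horiz_sum n (indicator S) (i, j) + (indicator S (i, j) :: bit)"
    using assms by (simp add: vert_sum_def horiz_sum_def ac_simps)
  ultimately show ?thesis
    by (metis of_nat_bit_eq_0_iff)
qed

lemma indicator_ker_Phi_grid:
  "indicator ` ker_Phi (grid_verts n) (grid_edges n) = grid_null n"
proof -
  let ?K = "ker_Phi (grid_verts n) (grid_edges n)"
  have ker_iff: "S \<in> ?K \<longleftrightarrow> indicator S \<in> grid_null n" if S: "S \<subseteq> grid_verts n" for S
  proof -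
    have "supp_on_grid n (indicator S)"
      using S by (auto simp: supp_on_grid_def indicator_def)
    moreover have "vert_sum n (indicator S) p + horiz_sum n (indicator S) p + indicator S p = 0"
      if "p \<notin> grid_verts n" for p
      using S that by (cases p) (auto simp: vert_sum_def horiz_sum_def indicator_def)
    ultimately have "indicator S \<in> grid_null n \<longleftrightarrow> (\<forall>p\<in>grid_verts n.
        vert_sum n (indicator S) p + horiz_sum n (indicator S) p + indicator S p = 0)"
      unfolding grid_null_def by blast
    also have "\<dots> \<longleftrightarrow> S \<in> ?K"
      using S even_card_nbhd_grid_iff[OF _ S] by (fastforce simp: ker_Phi_def Phi_def)
    finally show ?thesis by blast
  qed
  have "f \<in> indicator ` ?K" if f: "f \<in> grid_null n" for f
  proof -
    define S where "S = {p. f p = 1}"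
    have "f = indicator S"
      by (auto simp: S_def indicator_def fun_eq_iff)
    moreover have "S \<subseteq> grid_verts n"
      using f by (fastforce simp: S_def grid_null_def supp_on_grid_def)
    ultimately show ?thesis
      using ker_iff f by blast
  qed
  moreover have "?K \<subseteq> Pow (grid_verts n)"
    by (auto simp: ker_Phi_def)
  ultimately show ?thesis
    using ker_iff by blast
qed

lemma vert_sum_add: "vert_sum n (f + g) = vert_sum n f + vert_sum n g"
  by (auto simp: vert_sum_def fun_eq_iff ac_simps)

lemma supp_on_grid_vert_sum: "supp_on_grid n (vert_sum n f)"
  by (auto simp: vert_sum_def supp_on_grid_def)

text \<open>Left and right multiplication by \<open>A\<close> commute.\<close>

lemma vert_sum_horiz_sum_commute:
  assumes "supp_on_grid n f"
  shows "horiz_sum n (vert_sum n f) = vert_sum n (horiz_sum n f)"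
proof
  fix p :: "int \<times> int"
  obtain i j where p: "p = (i, j)" by (cases p)
  show "horiz_sum n (vert_sum n f) p = vert_sum n (horiz_sum n f) p"
  proof (cases "p \<in> grid_verts n")
    case True
    \<comment> \<open>Row \<open>i\<close> lies in the grid, so for \<open>k\<close> outside
      \<open>1..n\<close> both sides vanish by the support condition; the cut-off does no
      harm.\<close>
    have "vert_sum n f (i, k) = f (i - 1, k) + f (i + 1, k)" for k
      using assms True p by (auto simp: vert_sum_def supp_on_grid_def grid_verts_def)
    moreover have "horiz_sum n f (k, j) = f (k, j - 1) + f (k, j + 1)" for k
      using assms True p by (auto simp: horiz_sum_def supp_on_grid_def grid_verts_def)
    ultimately show ?thesis
      using p True by (simp add: vert_sum_def[of n "horiz_sum n f"] horiz_sum_def[of n "vert_sum n f"] ac_simps)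
  qed (simp add: p vert_sum_def horiz_sum_def)
qed

lemma grid_null_vert_sum:
  assumes "f \<in> grid_null n"
  shows "vert_sum n f \<in> grid_null n"
proof -
  have "vert_sum n f + horiz_sum n f + f = 0"
    using assms by (auto simp: grid_null_def fun_eq_iff)
  then have "vert_sum n (vert_sum n f) + vert_sum n (horiz_sum n f) + vert_sum n f = vert_sum n 0"
    by (metis vert_sum_add)
  also have "vert_sum n 0 = 0"
    by (auto simp: vert_sum_def fun_eq_iff)
  finally show ?thesis
    using assms
    by (simp add: grid_null_def supp_on_grid_vert_sum vert_sum_horiz_sum_commute fun_eq_iff)
qed

lemma grid_null_transpose:
  assumes "f \<in> grid_null n"
  shows "f \<circ> prod.swap \<in> grid_null n"
    and "vert_sum n (f \<circ> prod.swap) = horiz_sum n f \<circ> prod.swap"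
proof -
  have v: "vert_sum n (f \<circ> prod.swap) = horiz_sum n f \<circ> prod.swap"
    and h: "horiz_sum n (f \<circ> prod.swap) = vert_sum n f \<circ> prod.swap"
    by (auto simp: vert_sum_def horiz_sum_def fun_eq_iff grid_verts_def)
  show "vert_sum n (f \<circ> prod.swap) = horiz_sum n f \<circ> prod.swap"
    by (rule v)
  have "supp_on_grid n (f \<circ> prod.swap)"
    using assms by (auto simp: grid_null_def supp_on_grid_def grid_verts_def)
  then show "f \<circ> prod.swap \<in> grid_null n"
    using assms by (simp add: grid_null_def v h add.commute[of "vert_sum n f _"])
qed

section \<open>Linear recurrences and eigenvalues of the path\<close>

text \<open>The sequence repeats \<open>0, v 1\<close>. A nonzero value forces \<open>v 1\<close> to
  be nonzero, so zeros occur only at multiples of the period, and \<open>Suc n\<close> is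
  one.\<close>

lemma recurrence_eigenvalue_0:
  fixes v :: "nat \<Rightarrow> bit"
  assumes "v 0 = 0" "v (Suc n) = 0" and rec: "\<And>k. k < n \<Longrightarrow> v (Suc (Suc k)) = v k"
    and "k \<le> Suc n" "v k \<noteq> 0"
  shows "2 dvd Suc n"
proof -
  have "k \<le> Suc n \<Longrightarrow> v k = (if 2 dvd k then 0 else v 1)" for k
    by (induction k rule: induct_nat_012) (use assms(1) rec in auto)
  then show ?thesis
    using assms by (metis order_refl)
qed

text \<open>The same argument with the repeating block \<open>0, v 1, v 1\<close>.\<close>

lemma recurrence_eigenvalue_1:
  fixes v :: "nat \<Rightarrow> bit"
  assumes "v 0 = 0" "v (Suc n) = 0" and rec: "\<And>k. k < n \<Longrightarrow> v (Suc (Suc k)) = v (Suc k) + v k"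
    and "k \<le> Suc n" "v k \<noteq> 0"
  shows "3 dvd Suc n"
proof -
  have "k \<le> Suc n \<Longrightarrow> v k = (if 3 dvd k then 0 else v 1)" for k
  proof (induction k rule: induct_nat_012)
    case (ge2 k)
    have "k mod 3 = 0 \<or> k mod 3 = 1 \<or> k mod 3 = 2" by linarith
    then show ?case
      using ge2 rec[of k] by (elim disjE) (auto simp: dvd_eq_mod_eq_0 mod_Suc)
  qed (use assms(1) in auto)
  then show ?thesis
    using assms by (metis order_refl)
qed

text \<open>Here \<open>u = A v\<close> and \<open>A u = u + v\<close>, so that \<open>A\<close> acts on \<open>v\<close> as a primitive third root of unity.\<close>

lemma recurrence_eigenvalue_omega:
  fixes u v :: "nat \<Rightarrow> bit"
  assumes "v 0 = 0" "v (Suc n) = 0" "u 0 = 0" "u (Suc n) = 0"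
    and rec: "\<And>k. k < n \<Longrightarrow> v (Suc (Suc k)) = u (Suc k) + v k"
      "\<And>k. k < n \<Longrightarrow> u (Suc (Suc k)) = u (Suc k) + v (Suc k) + u k"
    and "k \<le> Suc n" "v k \<noteq> 0"
  shows "5 dvd Suc n"
proof (rule ccontr)
  have mod5: "m mod 5 = 0 \<or> m mod 5 = 1 \<or> m mod 5 = 2 \<or> m mod 5 = 3 \<or> m mod 5 = 4" for m :: nat
    by linarith
  \<comment> \<open>With \<open>a = v 1\<close> and \<open>b = u 1\<close>, the blocks of length
    five are \<open>0, a, b, b, a\<close> for \<open>v\<close> and
    \<open>0, b, a + b, a + b, b\<close> for \<open>u\<close>.\<close>
  have *: "k \<le> Suc n \<Longrightarrow>
      v k = (if k mod 5 = 0 then 0 else if k mod 5 = 1 \<or> k mod 5 = 4 then v 1 else u 1) \<and>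
      u k = (if k mod 5 = 0 then 0 else if k mod 5 = 1 \<or> k mod 5 = 4 then u 1 else u 1 + v 1)" for k
  proof (induction k rule: induct_nat_012)
    case (ge2 k)
    then show ?case
      using rec[of k] mod5[of k] by (elim disjE) (auto simp: mod_Suc ac_simps)
  qed (use assms(1,3) in auto)
  assume "\<not> 5 dvd Suc n"
  then have "v 1 = 0" "u 1 = 0"
    using *[of "Suc n"] assms(2,4) by (auto simp: dvd_eq_mod_eq_0 split: if_splits)
  then show False
    using *[of k] assms by (auto split: if_splits)
qed

lemma supp_on_grid_cases:
  assumes "supp_on_grid n f" "f p \<noteq> 0"
  obtains k j where "p = (int k, j)" "1 \<le> k" "k \<le> n" "1 \<le> j" "j \<le> int n"
proof -
  obtain i j where p: "p = (i, j)" by (cases p)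
  have "p \<in> grid_verts n"
    using assms unfolding supp_on_grid_def by blast
  then show ?thesis
    using that[of "nat i" j] p by (auto simp: grid_verts_def)
qed

lemma vert_sum_column:
  assumes "1 \<le> j" "j \<le> int n" "k < n"
  shows "f (int (Suc (Suc k)), j) = vert_sum n f (int (Suc k), j) + f (int k, j)"
proof -
  have "(int (Suc k), j) \<in> grid_verts n"
    using assms by (auto simp: grid_verts_def)
  then show ?thesis
    by (simp add: vert_sum_def ac_simps)
qed

text \<open>A column through a nonzero entry satisfies the recurrence; rows \<open>0\<close> and
  \<open>n + 1\<close> lie outside the grid and supply the boundary zeros.\<close>

lemma vert_sum_eigenvalue_0:
  assumes f: "supp_on_grid n f" and "f \<noteq> 0" "vert_sum n f = 0"
  shows "2 dvd Suc n"
proof -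
  obtain p where p: "f p \<noteq> 0"
    using assms by (auto simp: fun_eq_iff)
  then obtain k j where k: "p = (int k, j)" "1 \<le> k" "k \<le> n" "1 \<le> j" "j \<le> int n"
    using f supp_on_grid_cases by blast
  show ?thesis
  proof (rule recurrence_eigenvalue_0)
    show "f (int (Suc (Suc m)), j) = f (int m, j)" if "m < n" for m
      using vert_sum_column[OF k(4,5) that, of f] assms by simp
    show "f (int k, j) \<noteq> 0" "k \<le> Suc n"
      using p k by auto
  qed (use f in \<open>auto simp: supp_on_grid_def grid_verts_def\<close>)
qed

lemma vert_sum_eigenvalue_1:
  assumes f: "supp_on_grid n f" and "f \<noteq> 0" "vert_sum n f = f"
  shows "3 dvd Suc n"
proof -
  obtain p where p: "f p \<noteq> 0"
    using assms by (auto simp: fun_eq_iff)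
  then obtain k j where k: "p = (int k, j)" "1 \<le> k" "k \<le> n" "1 \<le> j" "j \<le> int n"
    using f supp_on_grid_cases by blast
  show ?thesis
  proof (rule recurrence_eigenvalue_1)
    show "f (int (Suc (Suc m)), j) = f (int (Suc m), j) + f (int m, j)" if "m < n" for m
      using vert_sum_column[OF k(4,5) that, of f] assms by simp
    show "f (int k, j) \<noteq> 0" "k \<le> Suc n"
      using p k by auto
  qed (use f in \<open>auto simp: supp_on_grid_def grid_verts_def\<close>)
qed

lemma vert_sum_eigenvalue_omega:
  assumes f: "supp_on_grid n f" and "f \<noteq> 0" "vert_sum n (vert_sum n f) = vert_sum n f + f"
  shows "5 dvd Suc n"
proof -
  obtain p where p: "f p \<noteq> 0"
    using assms by (auto simp: fun_eq_iff)
  then obtain k j where k: "p = (int k, j)" "1 \<le> k" "k \<le> n" "1 \<le> j" "j \<le> int n"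
    using f supp_on_grid_cases by blast
  show ?thesis
  proof (rule recurrence_eigenvalue_omega)
    show "f (int (Suc (Suc m)), j) = vert_sum n f (int (Suc m), j) + f (int m, j)" if "m < n" for m
      using vert_sum_column[OF k(4,5) that, of f] .
    show "vert_sum n f (int (Suc (Suc m)), j)
        = vert_sum n f (int (Suc m), j) + f (int (Suc m), j) + vert_sum n f (int m, j)" if "m < n" for m
      using vert_sum_column[OF k(4,5) that, of "vert_sum n f"] assms by simp
    show "f (int k, j) \<noteq> 0" "k \<le> Suc n"
      using p k by auto
  qed (use f supp_on_grid_vert_sum[of n f] in \<open>auto simp: supp_on_grid_def grid_verts_def\<close>)
qed

text \<open>Since \<open>X A = A X + X\<close>, an eigenvector of left multiplication for 0 or 1 is
  one of right multiplication for the other value. Transposing it yields both eigenvalues for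
  \<open>A\<close>.\<close>

lemma grid_null_eigenvector_imp:
  assumes f: "f \<in> grid_null n" "f \<noteq> 0" and eig: "vert_sum n f = 0 \<or> vert_sum n f = f"
  shows "6 dvd Suc n"
proof -
  let ?g = "f \<circ> prod.swap"
  have g: "?g \<in> grid_null n" "vert_sum n ?g = horiz_sum n f \<circ> prod.swap"
    using grid_null_transpose f by auto
  have "?g \<noteq> 0"
    using f(2) by (auto simp: fun_eq_iff)
  have supp: "supp_on_grid n f" "supp_on_grid n ?g"
    using f g by (auto simp: grid_null_def)
  have sum0: "vert_sum n f p + horiz_sum n f p + f p = 0" for p
    using f unfolding grid_null_def by blast
  have "2 dvd Suc n \<and> 3 dvd Suc n"
    using eig
  proof
    assume v: "vert_sum n f = 0"
    then have "horiz_sum n f = f"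
      using sum0 by (auto simp: fun_eq_iff bit_add_eq_0_iff)
    then show ?thesis
      using v g(2) f(2) \<open>?g \<noteq> 0\<close> supp vert_sum_eigenvalue_0 vert_sum_eigenvalue_1 by metis
  next
    assume v: "vert_sum n f = f"
    have "horiz_sum n f p = 0" for p
      using sum0[of p] unfolding v by (cases "f p"; cases "horiz_sum n f p") auto
    then have "vert_sum n ?g = 0"
      using g(2) by (auto simp: fun_eq_iff)
    then show ?thesis
      using v f(2) \<open>?g \<noteq> 0\<close> supp vert_sum_eigenvalue_0 vert_sum_eigenvalue_1 by metis
  qed
  then show ?thesis by presburger
qed

section \<open>A periodic solution from the 4 by 4 grid\<close>

text \<open>The reflected copies, with period ten in both directions, of the solution with rows
  \<open>1000\<close>, \<open>1100\<close>, \<open>1010\<close>, \<open>0111\<close> on the \<open>4 \<times> 4\<close> grid.\<close>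

definition tiling_row :: "int \<Rightarrow> int set" where
  "tiling_row i =
    (if i mod 10 \<in> {1, 9} then {1, 9} else if i mod 10 \<in> {2, 8} then {1, 2, 8, 9}
     else if i mod 10 \<in> {3, 7} then {1, 3, 7, 9} else if i mod 10 \<in> {4, 6} then {2, 3, 4, 6, 7, 8}
     else {})"

definition tiling :: "int \<times> int \<Rightarrow> bit" where
  "tiling = (\<lambda>(i, j). of_bool (j mod 10 \<in> tiling_row i))"

text \<open>A check of the 100 pairs of residues modulo 10. On the empty lines, neighbours on
  opposite sides cancel by reflection.\<close>

lemma tiling_local:
  "tiling (i - 1, j) + tiling (i + 1, j) + (tiling (i, j - 1) + tiling (i, j + 1)) + tiling (i, j) = 0"
proof -
  have residues: "k mod 10 = 0 \<and> (k + 1) mod 10 = 1 \<and> (k - 1) mod 10 = 9 \<or>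
      k mod 10 = 1 \<and> (k + 1) mod 10 = 2 \<and> (k - 1) mod 10 = 0 \<or>
      k mod 10 = 2 \<and> (k + 1) mod 10 = 3 \<and> (k - 1) mod 10 = 1 \<or>
      k mod 10 = 3 \<and> (k + 1) mod 10 = 4 \<and> (k - 1) mod 10 = 2 \<or>
      k mod 10 = 4 \<and> (k + 1) mod 10 = 5 \<and> (k - 1) mod 10 = 3 \<or>
      k mod 10 = 5 \<and> (k + 1) mod 10 = 6 \<and> (k - 1) mod 10 = 4 \<or>
      k mod 10 = 6 \<and> (k + 1) mod 10 = 7 \<and> (k - 1) mod 10 = 5 \<or>
      k mod 10 = 7 \<and> (k + 1) mod 10 = 8 \<and> (k - 1) mod 10 = 6 \<or>
      k mod 10 = 8 \<and> (k + 1) mod 10 = 9 \<and> (k - 1) mod 10 = 7 \<or>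
      k mod 10 = 9 \<and> (k + 1) mod 10 = 0 \<and> (k - 1) mod 10 = 8" for k :: int
  proof -
    have shift: "(k + 1) mod 10 = (r + 1) mod 10 \<and> (k - 1) mod 10 = (r - 1) mod 10"
      if "k mod 10 = r" for r
      unfolding that[symmetric] by (simp add: mod_simps)
    have "k mod 10 \<in> set [0..9]"
      by simp
    then have "k mod 10 = 0 \<or> k mod 10 = 1 \<or> k mod 10 = 2 \<or> k mod 10 = 3 \<or> k mod 10 = 4 \<or>
        k mod 10 = 5 \<or> k mod 10 = 6 \<or> k mod 10 = 7 \<or> k mod 10 = 8 \<or> k mod 10 = 9"
      by (simp add: upto.simps)
    then show ?thesis
      using shift[of 0] shift[of 1] shift[of 2] shift[of 3] shift[of 4]
        shift[of 5] shift[of 6] shift[of 7] shift[of 8] shift[of 9]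
      by (elim disjE) simp_all
  qed
  \<comment> \<open>Naming the residues keeps the simplifier's arithmetic for \<open>mod\<close> out of the 100 cases.\<close>
  define r r' r'' s s' s'' where resid: "r = i mod 10" "r' = (i + 1) mod 10" "r'' = (i - 1) mod 10"
    "s = j mod 10" "s' = (j + 1) mod 10" "s'' = (j - 1) mod 10"
  show ?thesis
    using residues[of i] residues[of j]
    unfolding tiling_def tiling_row_def prod.case resid[symmetric]
    by (elim disjE conjE) simp_all
qed

lemma tiling_eq_0:
  assumes "5 dvd i \<or> 5 dvd j"
  shows "tiling (i, j) = 0"
proof -
  have "i mod 10 = 0 \<or> i mod 10 = 5 \<or> j mod 10 = 0 \<or> j mod 10 = 5"
    using assms by presburger
  then show ?thesis
    unfolding tiling_def tiling_row_def by (elim disjE) simp_all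
qed

text \<open>The lines \<open>0\<close> and \<open>n + 1\<close> bounding the grid are multiples of
  5, where the tiling vanishes, so cutting it off there preserves the local equations.\<close>

lemma tiling_in_grid_null:
  assumes "5 dvd Suc n"
  defines "f \<equiv> (\<lambda>p. if p \<in> grid_verts n then tiling p else 0)"
  shows "f \<in> grid_null n" and "vert_sum n (vert_sum n f) \<noteq> vert_sum n f + f"
proof -
  have "5 dvd int (Suc n)"
    using assms(1) by presburger
  then have n5: "5 dvd int n + 1"
    by (simp add: add.commute)
  have f_eq: "f (i, j) = tiling (i, j)" if "0 \<le> i" "i \<le> int n + 1" "0 \<le> j" "j \<le> int n + 1" for i j
  proof (cases "(i, j) \<in> grid_verts n")
    case False
    then have "i = 0 \<or> i = int n + 1 \<or> j = 0 \<or> j = int n + 1"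
      using that by (auto simp: grid_verts_def)
    then show ?thesis
      using n5 tiling_eq_0[of i j] False by (auto simp: f_def)
  qed (simp add: f_def)
  have "vert_sum n f (i, j) + horiz_sum n f (i, j) + f (i, j) = 0" for i j
  proof (cases "(i, j) \<in> grid_verts n")
    case True
    then show ?thesis
      using tiling_local[of i j] f_eq by (simp add: vert_sum_def horiz_sum_def grid_verts_def)
  qed (simp add: vert_sum_def horiz_sum_def f_def)
  then show "f \<in> grid_null n"
    by (auto simp: grid_null_def supp_on_grid_def f_def)
  have "4 \<le> n"
    using assms(1) by presburger
  then have "(i, 2) \<in> grid_verts n \<longleftrightarrow> 1 \<le> i \<and> i \<le> int n" for i
    by (auto simp: grid_verts_def)
  \<comment> \<open>Column 2 begins \<open>0, 1, 0\<close>, so the left side is 0 and the right side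
    is 1.\<close>
  then have "vert_sum n (vert_sum n f) (1, 2) \<noteq> (vert_sum n f + f) (1, 2)"
    using \<open>4 \<le> n\<close> by (simp add: vert_sum_def f_eq tiling_def tiling_row_def)
  then show "vert_sum n (vert_sum n f) \<noteq> vert_sum n f + f"
    by metis
qed

section \<open>Planes over the two-element field\<close>

lemma dim_2_bit_elements:
  fixes K :: "('a \<Rightarrow> bit) set"
  assumes "module.subspace scale_bit K" "vector_space.dim scale_bit K = 2"
  obtains a b where "a \<noteq> 0" "b \<noteq> 0" "a \<noteq> b" "K = {0, a, b, a + b}"
proof -
  interpret vector_space "scale_bit :: bit \<Rightarrow> ('a \<Rightarrow> bit) \<Rightarrow> 'a \<Rightarrow> bit"
    by (rule vector_space_scale_bit)
  obtain B where B: "B \<subseteq> K" "independent B" "K \<subseteq> span B" "card B = 2"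
    using basis_exists[of K] assms(2) by metis
  have K: "K = span B"
    using B assms(1) span_minimal by blast
  obtain a b where ab: "B = {a, b}" "a \<noteq> b"
    using B(4) by (auto simp: card_2_iff)
  have "a \<noteq> 0" "b \<noteq> 0"
    using B(2) ab dependent_zero by auto
  have "x \<in> {0, a, b, a + b}" if "x \<in> span {a, b}" for x
  proof -
    obtain c where "x - scale_bit c a \<in> span {b}"
      using \<open>x \<in> span {a, b}\<close> by (auto simp: span_insert)
    then obtain d where "x - scale_bit c a = scale_bit d b"
      by (auto simp: span_singleton)
    then have "x = scale_bit c a + scale_bit d b"
      by (metis diff_add_cancel add.commute)
    then show ?thesis
      by (cases c; cases d) (auto simp: fun_eq_iff)
  qed
  moreover have "0 \<in> span {a, b}" "a \<in> span {a, b}" "b \<in> span {a, b}" "a + b \<in> span {a, b}"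
    by (auto intro: span_zero span_base span_add)
  ultimately have "K = {0, a, b, a + b}"
    unfolding K ab(1) by blast
  then show ?thesis
    using that \<open>a \<noteq> 0\<close> \<open>b \<noteq> 0\<close> ab(2) by blast
qed

text \<open>Such an \<open>L\<close> permutes the three nonzero vectors without fixed points, hence
  cyclically, and these three vectors sum to 0.\<close>

lemma klein_four_endo_without_eigenvector:
  fixes L :: "('a \<Rightarrow> bit) \<Rightarrow> 'a \<Rightarrow> bit"
  assumes add: "\<And>f g. L (f + g) = L f + L g"
    and maps: "\<And>f. f \<in> {0, a, b, a + b} \<Longrightarrow> L f \<in> {0, a, b, a + b}"
    and ab: "a \<noteq> 0" "b \<noteq> 0" "a \<noteq> b"
    and no_eig: "\<And>f. f \<in> {0, a, b, a + b} \<Longrightarrow> f \<noteq> 0 \<Longrightarrow> L f \<noteq> 0 \<and> L f \<noteq> f"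
    and f: "f \<in> {0, a, b, a + b}"
  shows "L (L f) = L f + f"
proof -
  have self: "g + g = 0" "g + (g + h) = h" for g h :: "'a \<Rightarrow> bit"
    by (auto simp: fun_eq_iff add.assoc[symmetric])
  have "a + b \<noteq> 0"
    using ab(3) by (auto simp: fun_eq_iff bit_add_eq_0_iff)
  then have La: "L a = b \<or> L a = a + b" and Lb: "L b = a \<or> L b = a + b"
    and Lab: "L a + L b \<noteq> 0" "L a + L b \<noteq> a + b"
    using maps[of a] maps[of b] no_eig[of a] no_eig[of b] no_eig[of "a + b"] ab add[of a b] by auto
  have "L 0 = 0"
    using add[of 0 0] by (metis add_cancel_right_right add_0)
  \<comment> \<open>Swapping \<open>a\<close> and \<open>b\<close> would fix \<open>a + b\<close>;
    sending both to \<open>a + b\<close> would kill it.\<close>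
  moreover have "L a = b \<and> L b = a + b \<or> L a = a + b \<and> L b = a"
    using La Lb Lab self(1) by (metis add.commute)
  ultimately show ?thesis
    using f by (auto simp: add self ac_simps)
qed

theorem theorem5:
  fixes n :: nat
  assumes "n > 0" and "d_grid n = 2"
  shows "[int n = -1] (mod 6)"
proof -
  have "module.subspace scale_bit (grid_null n)"
    using subspace_ker_Phi[OF finite_simple_graph_grid[of n]]
    by (simp only: indicator_ker_Phi_grid)
  moreover have "vector_space.dim scale_bit (grid_null n) = 2"
    using assms(2) by (simp only: d_grid_def ker_Phi_dim_def indicator_ker_Phi_grid)
  ultimately obtain a b where ab: "a \<noteq> 0" "b \<noteq> 0" "a \<noteq> b" and K: "grid_null n = {0, a, b, a + b}"
    by (rule dim_2_bit_elements)
  have "6 dvd Suc n"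
  proof (rule ccontr)
    assume "\<not> 6 dvd Suc n"
    then have no_eig: "vert_sum n f \<noteq> 0 \<and> vert_sum n f \<noteq> f" if "f \<in> grid_null n" "f \<noteq> 0" for f
      using grid_null_eigenvector_imp that by blast
    have quad: "vert_sum n (vert_sum n f) = vert_sum n f + f" if "f \<in> grid_null n" for f
    proof (rule klein_four_endo_without_eigenvector[OF vert_sum_add _ ab])
      show "f \<in> {0, a, b, a + b}"
        using that K by simp
      show "vert_sum n g \<in> {0, a, b, a + b}" if "g \<in> {0, a, b, a + b}" for g
        using grid_null_vert_sum[of g n] that K by simp
    qed (use K no_eig in blast)
    have "a \<in> grid_null n"
      using K by blast
    then have "5 dvd Suc n"
      using vert_sum_eigenvalue_omega[of n a] quad ab(1) by (auto simp: grid_null_def)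
    \<comment> \<open>The cut-off tiling lies in \<open>grid_null n\<close> but violates
      \<open>quad\<close>.\<close>
    then show False
      using tiling_in_grid_null quad by blast
  qed
  then show ?thesis
    unfolding cong_iff_dvd_diff by presburger
qed

end
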